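(* Let $\phi$, $\rho$, $\Omega$ and $\mathcal L_D$ be as in the context. For every $\mathbf q\in\mathbb R^3$, $$\mathcal L_D\left(0,\frac{\langle\mathbf q,y\rangle}{|y|^3}\right)=0 .$$
   Context: All notation is Euclidean on $\mathbb R^3$. Fix $\psi\in C_c^\infty((0,1))$ with $\psi\ge0$, $\int_0^1\psi=1$, and set $\phi(t)=t^{-3}\left[\tfrac12\psi\left(\tfrac1{2t}-1\right)-\psi\left(\tfrac1t-1\right)\right]$ for $t>0$ ($\psi$ extended by zero). Let $\rho(y)=|y|^{-1}$ and let $\Omega=B_\Lambda\setminus B_\lambda$, $0<\lambda<\Lambda<\infty$, be a fixed annulus centered at the origin such that the support of $\phi(\rho)$ is compactly contained in $\Omega$. For a continuous symmetric two-tensor $k$ on $\Omega$ and $v\in W^{1,p}(\Omega)$, $p>3$, $$\begin{aligned}\mathcal L_D(k,v)=&\int_\Omega\phi'(\rho)|\nabla\rho|^3v\,dy+3\int_\Omega\phi(\rho)|\nabla\rho|\langle\nabla\rho,\nabla v\rangle\,dy\\&+\int_\Omega\phi(\rho)\left[\tfrac12(\operatorname{tr}k)|\nabla\rho|^3-\tfrac32|\nabla\rho|\,k(\nabla\rho,\nabla\rho)\right]dy.\end{aligned}$$ *)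

theory Defs
  imports "HOL-Analysis.Analysis"
begin

primrec C_k :: "nat \<Rightarrow> ('a::real_normed_vector \<Rightarrow> real) \<Rightarrow> bool" where
  "C_k 0 f \<longleftrightarrow> continuous_on UNIV f"
| "C_k (Suc n) f \<longleftrightarrow>
     (\<forall>x. f differentiable (at x)) \<and> (\<forall>v. C_k n (\<lambda>x. frechet_derivative f (at x) v))"

definition C_infty :: "('a::real_normed_vector \<Rightarrow> real) \<Rightarrow> bool" where
  "C_infty f \<longleftrightarrow> (\<forall>n. C_k n f)"

definition compactly_contained :: "'a::topological_space set \<Rightarrow> 'a set \<Rightarrow> bool" where
  "compactly_contained A U \<longleftrightarrow> compact (closure A) \<and> closure A \<subseteq> U"

(* Elements of C_c^infty(U), already extended by zero to the whole space. *)
definition Cc_infty :: "'a::real_normed_vector set \<Rightarrow> ('a \<Rightarrow> real) set" where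
  "Cc_infty U = {f. C_infty f \<and> compactly_contained {x. f x \<noteq> 0} U}"

(* The classical gradient; meaningful only at points of differentiability. *)
definition grad :: "('a::real_inner \<Rightarrow> real) \<Rightarrow> 'a \<Rightarrow> 'a" where
  "grad f x = (THE D. GDERIV f x :> D)"


definition locally_integrable ::
    "'a::euclidean_space set \<Rightarrow> ('a \<Rightarrow> 'b::euclidean_space) \<Rightarrow> bool" where
  "locally_integrable U f \<longleftrightarrow> (\<forall>K. compact K \<and> K \<subseteq> U \<longrightarrow> set_integrable lebesgue K f)"

definition has_weak_gradient ::
    "'a::euclidean_space set \<Rightarrow> ('a \<Rightarrow> real) \<Rightarrow> ('a \<Rightarrow> 'a) \<Rightarrow> bool" where
  "has_weak_gradient U v G \<longleftrightarrow>
     locally_integrable U v \<and> locally_integrable U G \<and>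
     (\<forall>\<eta>\<in>Cc_infty U.
        (LINT y:U|lebesgue. v y *\<^sub>R grad \<eta> y) = - (LINT y:U|lebesgue. \<eta> y *\<^sub>R G y))"

(* A weak gradient on an open set is unique almost everywhere, so integrals over U
   do not depend on the choice of representative. *)
definition weak_grad :: "'a::euclidean_space set \<Rightarrow> ('a \<Rightarrow> real) \<Rightarrow> 'a \<Rightarrow> 'a" where
  "weak_grad U v = (SOME G. has_weak_gradient U v G)"

definition Lp_on :: "real \<Rightarrow> 'a::euclidean_space set \<Rightarrow> ('a \<Rightarrow> 'b::euclidean_space) set" where
  "Lp_on p U = {f. set_borel_measurable lebesgue U f \<and>
                   set_integrable lebesgue U (\<lambda>x. norm (f x) powr p)}"

definition W1p :: "real \<Rightarrow> 'a::euclidean_space set \<Rightarrow> ('a \<Rightarrow> real) set" where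
  "W1p p U = {v \<in> Lp_on p U. \<exists>G\<in>Lp_on p U. has_weak_gradient U v G}"


(* Only t > 0 is relevant.  For t \<le> 0 the value is 0 whenever \<psi> is supported in (0,1). *)
definition phi :: "(real \<Rightarrow> real) \<Rightarrow> real \<Rightarrow> real" where
  "phi \<psi> t = t powi (-3) * (1/2 * \<psi> (1 / (2 * t) - 1) - \<psi> (1 / t - 1))"

definition rho :: "real^3 \<Rightarrow> real" where
  "rho y = inverse (norm y)"

(* Taken open, so that it is a domain on which weak derivatives make sense. *)
definition annulus :: "real \<Rightarrow> real \<Rightarrow> (real^3) set" where
  "annulus r R = ball 0 R - cball 0 r"

(* A two-tensor k is given by its matrix field: k(X,Y) at y is X \<bullet> (k y *v Y).
   The gradient of rho is classical (the annulus avoids the origin), that of v is weak. *)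
definition L_D ::
    "(real^3) set \<Rightarrow> (real \<Rightarrow> real) \<Rightarrow> (real^3 \<Rightarrow> real^3^3) \<Rightarrow> (real^3 \<Rightarrow> real) \<Rightarrow> real" where
  "L_D \<Omega> \<phi> k v =
     (LINT y:\<Omega>|lebesgue. deriv \<phi> (rho y) * norm (grad rho y) ^ 3 * v y)
     + 3 * (LINT y:\<Omega>|lebesgue.
              \<phi> (rho y) * norm (grad rho y) * (grad rho y \<bullet> weak_grad \<Omega> v y))
     + (LINT y:\<Omega>|lebesgue.
          \<phi> (rho y) * (1/2 * trace (k y) * norm (grad rho y) ^ 3
                      - 3/2 * norm (grad rho y) * (grad rho y \<bullet> (k y *v grad rho y))))"

end

theory Submission
  imports Defs
begin

text \<open>
  Everything vanishes by parity under \<open>y \<mapsto> - y\<close>: the dipole \<open>v\<close> is odd, \<open>\<nabla>v\<close> is even and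
  \<open>\<nabla>\<rho>\<close> is odd, so both remaining integrands are odd on a symmetric domain. The weak gradient is
  only some representative; it enters through
  \<open>\<integral> \<phi>(\<rho>) \<bar>\<nabla>\<rho>\<bar> \<langle>\<nabla>\<rho>, b\<rangle> G\<close>, where the weight is itself a test function. By
  the definition of a weak gradient this integral does not depend on the choice of \<open>G\<close>, which
  may therefore be replaced by the classical gradient.
\<close>

subsection \<open>Functions of class \<open>C\<^sup>k\<close> on an open set\<close>

text \<open>Relative form of \<open>C_k\<close>, since \<open>norm\<close> and its inverse are
  smooth only away from the origin. Derivatives are those of the whole space, which is the right
  notion when \<open>S\<close> is open.\<close>

primrec C_k_on :: "'a::real_normed_vector set \<Rightarrow> nat \<Rightarrow> ('a \<Rightarrow> real) \<Rightarrow> bool" where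
  "C_k_on S 0 f \<longleftrightarrow> continuous_on S f"
| "C_k_on S (Suc n) f \<longleftrightarrow>
     (\<forall>x\<in>S. f differentiable (at x)) \<and> (\<forall>v. C_k_on S n (\<lambda>x. frechet_derivative f (at x) v))"

lemma C_k_on_UNIV: "C_k_on UNIV n f \<longleftrightarrow> C_k n f"
  by (induction n arbitrary: f) auto

text \<open>Since \<open>S\<close> is open, \<open>f\<close> and \<open>g\<close> agree near each of
  its points, so their derivatives agree on \<open>S\<close> as well.\<close>

lemma C_k_on_cong:
  assumes "open S" "\<And>x. x \<in> S \<Longrightarrow> f x = g x" "C_k_on S n f"
  shows "C_k_on S n g"
  using assms(2,3)
proof (induction n arbitrary: f g)
  case 0
  then show ?case by (metis C_k_on.simps(1) continuous_on_cong)
next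
  case (Suc n)
  have d: "(g has_derivative frechet_derivative f (at x)) (at x)" if "x \<in> S" for x
    using Suc.prems that
    by (metis C_k_on.simps(2) frechet_derivative_works has_derivative_transform_within_open assms(1))
  have "C_k_on S n (\<lambda>x. frechet_derivative g (at x) v)" for v
  proof (rule Suc.IH)
    show "frechet_derivative f (at x) v = frechet_derivative g (at x) v" if "x \<in> S" for x
      using d[OF that] frechet_derivative_at by metis
    show "C_k_on S n (\<lambda>x. frechet_derivative f (at x) v)"
      using Suc.prems by simp
  qed
  then show ?case using d by (auto simp: differentiable_def)
qed

text \<open>Lets an explicit derivative formula stand in for \<open>frechet_derivative\<close>; most
  closure rules below rest on it.\<close>

lemma C_k_on_SucI:
  assumes "open S"
    and der: "\<And>x. x \<in> S \<Longrightarrow> (f has_derivative f' x) (at x)"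
    and "\<And>v. C_k_on S n (\<lambda>x. f' x v)"
  shows "C_k_on S (Suc n) f"
proof -
  have "C_k_on S n (\<lambda>x. frechet_derivative f (at x) v)" for v
    by (rule C_k_on_cong[OF assms(1) _ assms(3)[of v]]) (metis der frechet_derivative_at)
  then show ?thesis
    using der by (auto simp: differentiable_def)
qed

lemma C_k_on_has_derivative:
  assumes "C_k_on S (Suc n) f" "x \<in> S"
  shows "(f has_derivative frechet_derivative f (at x)) (at x)"
  using assms frechet_derivative_works by auto

lemma C_k_on_SucD:
  assumes "C_k_on S (Suc n) f"
  shows "C_k_on S n f"
  using assms
proof (induction n arbitrary: f)
  case 0
  then show ?case
    by (auto simp: differentiable_on_def differentiable_at_withinI
        intro: differentiable_imp_continuous_on)
next
  case (Suc n)
  then show ?case by (metis C_k_on.simps(2))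
qed

lemma C_k_on_Un:
  assumes "open S" "open T" "C_k_on S n f" "C_k_on T n f"
  shows "C_k_on (S \<union> T) n f"
  using assms(3,4)
proof (induction n arbitrary: f)
  case 0
  then show ?case using assms(1,2) by (simp add: continuous_on_open_Un)
next
  case (Suc n)
  then show ?case by simp blast
qed

lemma C_k_on_const:
  assumes "open S"
  shows "C_k_on S n (\<lambda>x. c)"
proof (induction n arbitrary: c)
  case (Suc n)
  show ?case by (rule C_k_on_SucI[OF assms has_derivative_const]) (use Suc in auto)
qed auto

lemma C_k_on_add:
  assumes "open S" "C_k_on S n f" "C_k_on S n g"
  shows "C_k_on S n (\<lambda>x. f x + g x)"
  using assms(2,3)
proof (induction n arbitrary: f g)
  case 0
  then show ?case by (simp add: continuous_on_add)
next
  case (Suc n)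
  show ?case
  proof (rule C_k_on_SucI[OF assms(1)])
    show "((\<lambda>x. f x + g x) has_derivative
        (\<lambda>v. frechet_derivative f (at x) v + frechet_derivative g (at x) v)) (at x)" if "x \<in> S" for x
      using Suc.prems[THEN C_k_on_has_derivative, OF that] by (rule has_derivative_add)
    show "C_k_on S n (\<lambda>x. frechet_derivative f (at x) v + frechet_derivative g (at x) v)" for v
      using Suc.prems by (intro Suc.IH) simp_all
  qed
qed

lemma C_k_on_mult:
  assumes "open S" "C_k_on S n f" "C_k_on S n g"
  shows "C_k_on S n (\<lambda>x. f x * g x)"
  using assms(2,3)
proof (induction n arbitrary: f g)
  case 0
  then show ?case by (simp add: continuous_on_mult)
next
  case (Suc n)
  show ?case
  proof (rule C_k_on_SucI[OF assms(1)])
    show "((\<lambda>x. f x * g x) has_derivative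
        (\<lambda>v. f x * frechet_derivative g (at x) v + frechet_derivative f (at x) v * g x)) (at x)"
      if "x \<in> S" for x
      using Suc.prems[THEN C_k_on_has_derivative, OF that] by (rule has_derivative_mult)
    show "C_k_on S n (\<lambda>x. f x * frechet_derivative g (at x) v + frechet_derivative f (at x) v * g x)"
      for v
      \<comment> \<open>The product rule leaves \<open>f\<close> and \<open>g\<close>
        undifferentiated in one factor each; \<open>C_k_on_SucD\<close> lowers their order to
        \<open>n\<close>.\<close>
      using Suc.prems Suc.prems[THEN C_k_on_SucD] by (intro C_k_on_add assms(1) Suc.IH) simp_all
  qed
qed

text \<open>By the chain rule. The induction generalizes over \<open>h\<close>, because its
  hypothesis is applied to the derivative of \<open>h\<close>.\<close>

lemma C_k_on_compose:
  fixes h :: "real \<Rightarrow> real"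
  assumes "open S" "C_k n h" "C_k_on S n f"
  shows "C_k_on S n (\<lambda>x. h (f x))"
  using assms(2,3)
proof (induction n arbitrary: f h)
  case 0
  then show ?case using continuous_on_compose2[of UNIV h S f] by simp
next
  case (Suc n)
  show ?case
  proof (rule C_k_on_SucI[OF assms(1)])
    let ?h' = "\<lambda>x. frechet_derivative h (at x) 1"
    show "((\<lambda>x. h (f x)) has_derivative
        (\<lambda>v. ?h' (f x) * frechet_derivative f (at x) v)) (at x)" if "x \<in> S" for x
    proof -
      have "(h has_derivative frechet_derivative h (at (f x))) (at (f x))"
        using Suc.prems(1) unfolding C_k_on_UNIV[symmetric]
        by (rule C_k_on_has_derivative) simp
      moreover have "(f has_derivative frechet_derivative f (at x)) (at x)"
        using Suc.prems(2) that by (rule C_k_on_has_derivative)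
      ultimately have d: "((\<lambda>x. h (f x)) has_derivative
         (\<lambda>v. frechet_derivative h (at (f x)) (frechet_derivative f (at x) v))) (at x)"
        by (rule has_derivative_compose[rotated])
      \<comment> \<open>A linear map on the reals is multiplication by its value at 1, so the chain
        rule becomes a product with the ordinary derivative \<open>?h'\<close>.\<close>
      have "linear (frechet_derivative h (at (f x)))"
        using Suc.prems(1) by (intro linear_frechet_derivative) simp
      then have "frechet_derivative h (at (f x)) t = ?h' (f x) * t" for t
        using linear_cmul[of "frechet_derivative h (at (f x))" t 1] by (simp add: mult.commute)
      then have eq: "(\<lambda>v. frechet_derivative h (at (f x)) (frechet_derivative f (at x) v))
          = (\<lambda>v. ?h' (f x) * frechet_derivative f (at x) v)"
        by (intro ext)
      show ?thesis using d unfolding eq .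
    qed
    show "C_k_on S n (\<lambda>x. ?h' (f x) * frechet_derivative f (at x) v)" for v
    proof (rule C_k_on_mult[OF assms(1)])
      show "C_k_on S n (\<lambda>x. ?h' (f x))"
        using Suc.prems(1) by (intro Suc.IH[of ?h' f] C_k_on_SucD[OF Suc.prems(2)]) simp
      show "C_k_on S n (\<lambda>x. frechet_derivative f (at x) v)"
        using Suc.prems(2) by simp
    qed
  qed
qed

section \<open>Smoothness of the norm and its inverse away from the origin\<close>

lemma C_k_on_inner:
  assumes "open S"
  shows "C_k_on S n (\<lambda>x. x \<bullet> v)"
proof (cases n)
  case (Suc m)
  show ?thesis unfolding Suc
    by (rule C_k_on_SucI[OF assms]) (auto intro!: derivative_eq_intros C_k_on_const assms)
qed (auto intro: continuous_intros)

lemma has_derivative_inverse_norm: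
  fixes x :: "'a::real_inner"
  assumes "x \<noteq> 0"
  shows "((\<lambda>x. inverse (norm x)) has_derivative (\<lambda>v. (-1) * ((x \<bullet> v) * inverse (norm x) ^ 3))) (at x)"
  using GDERIV_inverse[OF GDERIV_norm[OF assms]] assms
  by (simp add: gderiv_def sgn_div_norm power2_eq_square power3_eq_cube inner_commute mult_ac)

text \<open>The derivative is a polynomial in \<open>x \<bullet> v\<close> and
  \<open>inverse (norm x)\<close> itself, so the induction closes.\<close>

lemma C_k_on_inverse_norm:
  fixes S :: "'a::real_inner set"
  assumes "open S" "0 \<notin> S"
  shows "C_k_on S n (\<lambda>x. inverse (norm x))"
proof (induction n)
  case 0
  then show ?case using assms by (auto intro!: continuous_intros)
next
  case (Suc n)
  show ?case
  proof (rule C_k_on_SucI[OF assms(1)])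
    show "((\<lambda>x. inverse (norm x)) has_derivative (\<lambda>v. (-1) * ((x \<bullet> v) * inverse (norm x) ^ 3))) (at x)"
      if "x \<in> S" for x
      using that assms by (intro has_derivative_inverse_norm) auto
    show "C_k_on S n (\<lambda>x. (-1) * ((x \<bullet> v) * inverse (norm x) ^ 3))" for v
      unfolding power3_eq_cube
      by (intro C_k_on_mult C_k_on_const C_k_on_inner assms Suc)
  qed
qed

lemma C_k_on_norm:
  fixes S :: "'a::euclidean_space set"
  assumes "open S" "0 \<notin> S"
  shows "C_k_on S n norm"
proof (cases n)
  case (Suc m)
  show ?thesis unfolding Suc
  proof (rule C_k_on_SucI[OF assms(1)])
    show "(norm has_derivative (\<lambda>v. (x \<bullet> v) * inverse (norm x))) (at x)" if "x \<in> S" for x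
    proof -
      have "x \<noteq> 0" using that assms by auto
      then show ?thesis
        using GDERIV_norm[of x] by (simp add: gderiv_def sgn_div_norm inner_commute mult.commute)
    qed
    show "C_k_on S m (\<lambda>x. (x \<bullet> v) * inverse (norm x))" for v
      by (intro C_k_on_mult C_k_on_inner C_k_on_inverse_norm assms)
  qed
qed (auto intro: continuous_intros)

lemma C_k_on_power:
  assumes "open S" "C_k_on S n f"
  shows "C_k_on S n (\<lambda>x. f x ^ k)"
  by (induction k) (simp_all add: C_k_on_const C_k_on_mult assms)

text \<open>\<open>U\<close> and the complement of \<open>K\<close> form an open cover of the space;
  \<open>f\<close> is smooth on the first and zero on the second.\<close>

lemma C_infty_zero_extension:
  assumes "open U" "closed K" "K \<subseteq> U" "\<And>n. C_k_on U n f" "\<And>x. x \<notin> K \<Longrightarrow> f x = 0"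
  shows "C_infty f"
proof -
  have "C_k_on (U \<union> - K) n f" for n
  proof (rule C_k_on_Un)
    show "C_k_on (- K) n f"
      by (rule C_k_on_cong[OF _ _ C_k_on_const[of _ _ 0]]) (use assms(2,5) in auto)
  qed (use assms in auto)
  moreover have "U \<union> - K = UNIV" using assms(3) by auto
  ultimately show ?thesis by (simp add: C_infty_def C_k_on_UNIV)
qed

subsection \<open>Classical gradients are weak gradients\<close>

lemma grad_eq:
  assumes "GDERIV f x :> D"
  shows "grad f x = D"
proof -
  have "E = D" if "GDERIV f x :> E" for E
  proof -
    have "h \<bullet> E = h \<bullet> D" for h
      using has_derivative_unique[OF that[unfolded gderiv_def] assms[unfolded gderiv_def]] by meson
    then show ?thesis by (metis inner_commute vector_eq_rdot)
  qed
  then show ?thesis unfolding grad_def using assms by blast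
qed

text \<open>The Riesz vector of the derivative has as coordinates the values of the derivative on
  the basis.\<close>

lemma GDERIV_grad:
  fixes f :: "'a::euclidean_space \<Rightarrow> real"
  assumes "f differentiable (at x)"
  shows "GDERIV f x :> grad f x"
proof -
  let ?f' = "frechet_derivative f (at x)" 
  let ?D = "\<Sum>b\<in>Basis. ?f' b *\<^sub>R b"
  have lin: "linear ?f'" using assms by (rule linear_frechet_derivative)
  have "?f' h = h \<bullet> ?D" for h
  proof -
    have "?f' h = ?f' (\<Sum>b\<in>Basis. (h \<bullet> b) *\<^sub>R b)" by (simp add: euclidean_representation)
    also have "\<dots> = (\<Sum>b\<in>Basis. (h \<bullet> b) * ?f' b)"
      by (simp only: linear_sum[OF lin] linear_cmul[OF lin] real_scaleR_def)
    also have "\<dots> = h \<bullet> ?D" by (simp add: inner_sum_right mult.commute)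
    finally show ?thesis .
  qed
  then have "?f' = (\<lambda>h. h \<bullet> ?D)" by (rule ext)
  with assms[unfolded frechet_derivative_works] have "GDERIV f x :> ?D"
    unfolding gderiv_def by (rule has_derivative_eq_rhs)
  then show ?thesis by (simp only: grad_eq)
qed

section \<open>Integrals of compactly supported functions and isometric substitutions\<close>

lemma continuous_on_UNIV_zero_extension:
  fixes h :: "'a::topological_space \<Rightarrow> 'b::{topological_space,zero}"
  assumes "open U" "closed K" "K \<subseteq> U" "continuous_on U h" "\<And>x. x \<notin> K \<Longrightarrow> h x = 0"
  shows "continuous_on UNIV h"
proof -
  have "continuous_on (- K) h"
    using assms(5) continuous_on_const[of "-K" "0::'b"] by (subst continuous_on_cong[OF refl, of _ _ "\<lambda>_. 0"]) auto
  then have "continuous_on (U \<union> - K) h"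
    using assms by (intro continuous_on_open_Un) auto
  moreover have "U \<union> - K = UNIV" using assms(3) by auto
  ultimately show ?thesis by simp
qed

lemma integrable_continuous_compact_support:
  fixes h :: "'a::euclidean_space \<Rightarrow> 'b::euclidean_space"
  assumes "continuous_on UNIV h" "compact K" "\<And>x. x \<notin> K \<Longrightarrow> h x = 0"
  shows "integrable lebesgue h"
proof -
  have "integrable lborel (\<lambda>x. indicator K x *\<^sub>R h x)"
    using assms by (intro borel_integrable_compact) (auto intro: continuous_on_subset)
  moreover have "(\<lambda>x. indicator K x *\<^sub>R h x) = h"
    using assms(3) by (auto simp: fun_eq_iff indicator_def)
  ultimately show ?thesis by (simp add: integrable_completion)
qed

lemma set_integrable_lebesgue_compact:
  fixes h :: "'a::euclidean_space \<Rightarrow> 'b::euclidean_space"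
  assumes "compact K" "continuous_on K h"
  shows "set_integrable lebesgue K h"
  using borel_integrable_compact[OF assms] unfolding set_integrable_def
  by (simp add: integrable_completion)

text \<open>One statement for translations (\<open>c = 1\<close>) and the reflection
  \<open>c = -1\<close>; both preserve Lebesgue measure because
  \<open>\<bar>c\<bar> = 1\<close>.\<close>

lemma
  fixes f :: "'a::euclidean_space \<Rightarrow> 'b::euclidean_space" and c :: real
  assumes "\<bar>c\<bar> = 1"
  shows lebesgue_integrable_affine:
      "integrable lebesgue f \<Longrightarrow> integrable lebesgue (\<lambda>x. f (t + c *\<^sub>R x))"
    and lebesgue_integral_affine:
      "(LINT x|lebesgue. f (t + c *\<^sub>R x)) = (LINT x|lebesgue. f x)"
proof -
  have c: "c \<noteq> 0" "c * c = 1" using assms by (auto simp: abs_if split: if_splits)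
  have T: "(\<lambda>x::'a. s + (\<Sum>j\<in>Basis. (c * (x \<bullet> j)) *\<^sub>R j)) = (\<lambda>x. s + c *\<^sub>R x)" for s
    by (simp add: scaleR_scaleR[symmetric] scaleR_sum_right[symmetric] euclidean_representation
        del: scaleR_scaleR)
  have meas: "(\<lambda>x::'a. s + c *\<^sub>R x) \<in> lebesgue \<rightarrow>\<^sub>M lebesgue" for s
    using lebesgue_affine_measurable[of "\<lambda>_. c" s] c by (simp add: T)
  have distr: "distr lebesgue lebesgue (\<lambda>x::'a. t + c *\<^sub>R x) = lebesgue"
    using lebesgue_affine_euclidean[of "\<lambda>_. c" t] c assms by (simp add: T density_1)
  show int: "integrable lebesgue f \<Longrightarrow> integrable lebesgue (\<lambda>x. f (t + c *\<^sub>R x))"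
    using integrable_distr[OF meas[of t], of f] distr by simp
  show "(LINT x|lebesgue. f (t + c *\<^sub>R x)) = (LINT x|lebesgue. f x)"
  proof (cases "f \<in> borel_measurable lebesgue")
    case True
    then show ?thesis using integral_distr[OF meas[of t], of f] distr by simp
  next
    case False
    \<comment> \<open>Composing with the inverse map, which is again affine with factor
      \<open>c\<close> since \<open>c * c = 1\<close>, would make \<open>f\<close> measurable. Hence
      neither side is integrable and both integrals take the default value 0.\<close>
    have "(\<lambda>x. f (t + c *\<^sub>R x)) \<notin> borel_measurable lebesgue"
    proof
      assume "(\<lambda>x. f (t + c *\<^sub>R x)) \<in> borel_measurable lebesgue"
      from measurable_compose[OF meas[of "- c *\<^sub>R t"] this] show False
        using False c by (simp add: scaleR_diff_right)
    qed
    then show ?thesis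
      using False by (metis borel_measurable_integrable not_integrable_integral_eq)
  qed
qed

text \<open>
  By translation invariance the difference quotients have integral zero; they converge
  dominatedly because the derivative is bounded.
\<close>
lemma integral_derivative_compact_support:
  fixes f :: "'a::euclidean_space \<Rightarrow> real"
  assumes der: "\<And>x. (f has_derivative f' x) (at x)"
    and cont: "continuous_on UNIV (\<lambda>x. f' x e)"
    and K: "compact K" "\<And>x. x \<notin> K \<Longrightarrow> f x = 0"
  shows "(LINT x|lebesgue. f' x e) = 0"
proof -
  define c :: "nat \<Rightarrow> real" where "c n = inverse (real (Suc n))" for n
  have c: "c n > 0" "c n \<le> 1" for n by (auto simp: c_def field_simps)
  have clim: "c \<longlonglongrightarrow> 0" unfolding c_def by (rule LIMSEQ_inverse_real_of_nat)
  define s where "s n x = (f (x + c n *\<^sub>R e) - f x) / c n" for n x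
  have fcont: "continuous_on UNIV f"
    using has_derivative_continuous_on[of UNIV f f'] der by simp
  have f0: "f' x e = 0" if "x \<notin> K" for x
  proof -
    have "((\<lambda>_. 0) has_derivative f' x) (at x)"
      by (rule has_derivative_transform_within_open[OF der, where s = "- K"])
        (use K that in \<open>auto simp: compact_imp_closed\<close>)
    then show ?thesis by (metis has_derivative_const has_derivative_unique)
  qed
  have "bounded ((\<lambda>x. f' x e) ` K)"
    using K cont by (intro compact_imp_bounded compact_continuous_image) (auto intro: continuous_on_subset)
  then obtain B where B0: "\<And>x. x \<in> K \<Longrightarrow> \<bar>f' x e\<bar> \<le> B" unfolding bounded_iff by auto
  \<comment> \<open>The maximum with 0 covers points outside \<open>K\<close>, also when
    \<open>K\<close> is empty and \<open>B\<close> is negative.\<close>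
  define B' where "B' = max B 0"
  have B: "\<bar>f' x e\<bar> \<le> B'" for x
    using B0[of x] f0[of x] by (cases "x \<in> K") (auto simp: B'_def)
  obtain M where M: "\<And>x. x \<in> K \<Longrightarrow> norm x \<le> M"
    using K(1) compact_imp_bounded bounded_iff by metis
  \<comment> \<open>As \<open>c n \<le> 1\<close>, a shift moves points by at most
    \<open>norm e\<close>, so this one ball contains the supports of all difference
    quotients.\<close>
  define C where "C = cball (0::'a) (M + norm e)"
  have s0: "s n x = 0" if "x \<notin> C" for n x
  proof -
    have x: "norm x > M + norm e" using that by (auto simp: C_def)
    have "norm (c n *\<^sub>R e) \<le> norm e" using c[of n] by (simp add: mult_left_le_one_le)
    then have "norm (x + c n *\<^sub>R e) > M"
      using x norm_diff_ineq[of x "c n *\<^sub>R e"] by linarith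
    moreover have "norm x > M" using x norm_ge_zero[of e] by linarith
    ultimately have "x + c n *\<^sub>R e \<notin> K" "x \<notin> K" using M leD by blast+
    then show ?thesis using K by (simp add: s_def)
  qed
  \<comment> \<open>The mean value theorem along the segment in direction \<open>e\<close> makes the
    bound uniform in \<open>n\<close>.\<close>
  have sB: "\<bar>s n x\<bar> \<le> B'" for n x
  proof -
    have d: "((\<lambda>t. f (x + t *\<^sub>R e)) has_real_derivative f' (x + t *\<^sub>R e) e) (at t)" for t
    proof -
      have "((\<lambda>t. f (x + t *\<^sub>R e)) has_derivative (\<lambda>h. f' (x + t *\<^sub>R e) (h *\<^sub>R e))) (at t)"
        by (rule has_derivative_compose[OF _ der]) (auto intro!: derivative_eq_intros)
      moreover have "f' (x + t *\<^sub>R e) (h *\<^sub>R e) = f' (x + t *\<^sub>R e) e * h" for h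
        using linear_cmul[OF has_derivative_linear[OF der]] by (simp add: mult.commute)
      ultimately show ?thesis by (simp add: has_field_derivative_def)
    qed
    obtain z where "f (x + c n *\<^sub>R e) - f (x + 0 *\<^sub>R e) = (c n - 0) * f' (x + z *\<^sub>R e) e"
      using MVT2[OF c(1)[of n] d] by auto
    then have "s n x = f' (x + z *\<^sub>R e) e" using c(1)[of n] by (simp add: s_def)
    then show ?thesis using B by simp
  qed
  have slim: "(\<lambda>n. s n x) \<longlonglongrightarrow> f' x e" for x
  proof -
    have "((\<lambda>t. f (x + t *\<^sub>R e)) has_derivative (\<lambda>h. f' (x + 0 *\<^sub>R e) (h *\<^sub>R e))) (at 0)"
      by (rule has_derivative_compose[OF _ der]) (auto intro!: derivative_eq_intros)
    moreover have "f' x (h *\<^sub>R e) = f' x e * h" for h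
      using linear_cmul[OF has_derivative_linear[OF der]] by (simp add: mult.commute)
    ultimately have "((\<lambda>t. f (x + t *\<^sub>R e)) has_real_derivative f' x e) (at 0)"
      by (simp add: has_field_derivative_def)
    then have "((\<lambda>h. (f (x + h *\<^sub>R e) - f x) / h) \<longlongrightarrow> f' x e) (at 0)"
      by (simp add: DERIV_def)
    moreover have "filterlim c (at 0) sequentially"
      using clim c(1) by (auto simp: filterlim_at less_imp_neq[symmetric] intro!: always_eventually)
    ultimately show ?thesis unfolding s_def by (rule filterlim_compose)
  qed
  have fint: "integrable lebesgue f"
    using fcont K by (rule integrable_continuous_compact_support)
  have scont: "continuous_on UNIV (s n)" for n
    unfolding s_def using c(1)[of n]
    by (intro continuous_intros continuous_on_compose2[OF fcont]) auto
  have sint: "(LINT x|lebesgue. s n x) = 0" for n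
  proof -
    have "(LINT x|lebesgue. s n x)
        = ((LINT x|lebesgue. f (c n *\<^sub>R e + 1 *\<^sub>R x)) - (LINT x|lebesgue. f x)) / c n"
      unfolding s_def using fint lebesgue_integrable_affine[of 1 f "c n *\<^sub>R e"]
      by (simp add: add.commute)
    also have "\<dots> = 0"
      by (subst lebesgue_integral_affine) auto
    finally show ?thesis .
  qed
  have "(\<lambda>n. LINT x|lebesgue. s n x) \<longlonglongrightarrow> (LINT x|lebesgue. f' x e)"
  proof (rule integral_dominated_convergence[where w = "\<lambda>x. B' * indicator C x"])
    show "(\<lambda>x. f' x e) \<in> borel_measurable lebesgue"
      using borel_measurable_continuous_onI[OF cont] by (intro measurable_completion) simp
    show "s n \<in> borel_measurable lebesgue" for n
      using borel_measurable_continuous_onI[OF scont] by (intro measurable_completion) simp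
    have "set_integrable lebesgue C (\<lambda>_. B')"
      by (rule set_integrable_lebesgue_compact) (auto simp: C_def)
    then show "integrable lebesgue (\<lambda>x. B' * indicator C x)"
      by (simp add: set_integrable_def mult.commute)
    show "AE x in lebesgue. norm (s n x) \<le> B' * indicator C x" for n
      using s0 sB by (auto simp: indicator_def)
    show "AE x in lebesgue. (\<lambda>n. s n x) \<longlonglongrightarrow> f' x e"
      using slim by auto
  qed
  then show ?thesis using sint by (simp add: LIMSEQ_const_iff)
qed

section \<open>Integration by parts against test functions\<close>

lemma Cc_inftyD:
  fixes \<eta> :: "'a::euclidean_space \<Rightarrow> real"
  assumes "\<eta> \<in> Cc_infty U"
  shows "\<eta> differentiable (at x)" "continuous_on UNIV \<eta>" "continuous_on UNIV (\<lambda>x. grad \<eta> x \<bullet> e)"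
proof -
  have "C_k 2 \<eta>" using assms by (auto simp: Cc_infty_def C_infty_def)
  then have *: "\<And>x. \<eta> differentiable (at x)" "\<And>v. C_k 1 (\<lambda>x. frechet_derivative \<eta> (at x) v)"
    by (auto simp: numeral_2_eq_2)
  show "\<eta> differentiable (at x)" by fact
  show "continuous_on UNIV \<eta>"
    using * by (auto intro!: differentiable_imp_continuous_on simp: differentiable_on_def)
  have "continuous_on UNIV (\<lambda>x. frechet_derivative \<eta> (at x) e)"
    using *(2)[of e]
    by (intro differentiable_imp_continuous_on) (auto simp: differentiable_on_def)
  moreover have "frechet_derivative \<eta> (at x) e = grad \<eta> x \<bullet> e" for x
    using GDERIV_grad[OF *(1)[of x]] frechet_derivative_at
    unfolding gderiv_def by (metis inner_commute)
  ultimately show "continuous_on UNIV (\<lambda>x. grad \<eta> x \<bullet> e)" by simp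
qed

text \<open>For a test function \<open>\<eta>\<close>, the product \<open>v y * \<eta> y\<close> is
  differentiable on the whole space with compact support, so its directional derivatives integrate
  to zero; the product rule turns this into the weak identity.\<close>

lemma has_weak_gradient_classical:
  fixes U :: "'a::euclidean_space set"
  assumes U: "open U" and der: "\<And>x. x \<in> U \<Longrightarrow> GDERIV v x :> G x" and G: "continuous_on U G"
  shows "has_weak_gradient U v G"
proof -
  have v: "continuous_on U v"
    using der unfolding gderiv_def
    by (meson has_derivative_continuous continuous_at_imp_continuous_on)
  have "locally_integrable U v" "locally_integrable U G"
    unfolding locally_integrable_def using v G
    by (auto intro!: set_integrable_lebesgue_compact intro: continuous_on_subset)
  moreover have "(LINT y:U|lebesgue. v y *\<^sub>R grad \<eta> y) = - (LINT y:U|lebesgue. \<eta> y *\<^sub>R G y)"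
    if eta: "\<eta> \<in> Cc_infty U" for \<eta>
  proof -
    define K where "K = closure {x. \<eta> x \<noteq> 0}"
    have K: "compact K" "closed K" "K \<subseteq> U"
      using eta by (auto simp: K_def Cc_infty_def compactly_contained_def)
    have eta0: "\<eta> x = 0" if "x \<notin> K" for x
      using that closure_subset[of "{x. \<eta> x \<noteq> 0}"] by (auto simp: K_def)
    have grad0: "grad \<eta> x = 0" if "x \<notin> K" for x
    proof -
      have "((\<lambda>_. 0) has_derivative (\<lambda>h. h \<bullet> 0)) (at x)" by simp
      then have "GDERIV \<eta> x :> 0"
        unfolding gderiv_def
        by (rule has_derivative_transform_within_open[where s = "- K"])
          (use K that eta0 in auto)
      then show ?thesis by (rule grad_eq)
    qed
    have gradc: "continuous_on UNIV (grad \<eta>)"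
      using Cc_inftyD(3)[OF eta] continuous_on_componentwise[of UNIV "grad \<eta>"] by blast
    have c1: "continuous_on UNIV (\<lambda>y. v y *\<^sub>R grad \<eta> y)"
      using v gradc grad0 K
      by (intro continuous_on_UNIV_zero_extension[OF U K(2,3)])
        (auto intro!: continuous_intros intro: continuous_on_subset)
    have c2: "continuous_on UNIV (\<lambda>y. \<eta> y *\<^sub>R G y)"
      using G Cc_inftyD(2)[OF eta] eta0 K
      by (intro continuous_on_UNIV_zero_extension[OF U K(2,3)])
        (auto intro!: continuous_intros intro: continuous_on_subset)
    have i1: "integrable lebesgue (\<lambda>y. v y *\<^sub>R grad \<eta> y)"
      using c1 K(1) grad0 by (intro integrable_continuous_compact_support) auto
    have i2: "integrable lebesgue (\<lambda>y. \<eta> y *\<^sub>R G y)"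
      using c2 K(1) eta0 by (intro integrable_continuous_compact_support) auto
    \<comment> \<open>Off \<open>U\<close> the values of \<open>v\<close> are arbitrary, but the
      product vanishes near such points because \<open>\<eta>\<close> does.\<close>
    have d: "((\<lambda>y. v y * \<eta> y) has_derivative (\<lambda>h. h \<bullet> (v x *\<^sub>R grad \<eta> x + \<eta> x *\<^sub>R G x))) (at x)" for x
    proof (cases "x \<in> U")
      case True
      have "(v has_derivative (\<lambda>h. h \<bullet> G x)) (at x)" "(\<eta> has_derivative (\<lambda>h. h \<bullet> grad \<eta> x)) (at x)"
        using der[OF True] GDERIV_grad[OF Cc_inftyD(1)[OF eta]] unfolding gderiv_def by auto
      from has_derivative_mult[OF this] show ?thesis
        by (simp add: inner_add_right mult.commute)
    next
      case False
      then have x: "x \<notin> K" using K by auto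
      have "((\<lambda>_. 0) has_derivative (\<lambda>h. h \<bullet> (v x *\<^sub>R grad \<eta> x + \<eta> x *\<^sub>R G x))) (at x)"
        using eta0[OF x] grad0[OF x] by simp
      then show ?thesis
        by (rule has_derivative_transform_within_open[where s = "- K"]) (use K x eta0 in auto)
    qed
    \<comment> \<open>Testing against every direction \<open>e\<close> reduces the vector identity
      to scalar integrals of derivatives.\<close>
    have "(LINT y|lebesgue. v y *\<^sub>R grad \<eta> y + \<eta> y *\<^sub>R G y) \<bullet> e = 0" for e
    proof -
      have "(LINT y|lebesgue. e \<bullet> (v y *\<^sub>R grad \<eta> y + \<eta> y *\<^sub>R G y)) = 0"
      proof (rule integral_derivative_compact_support[OF d _ K(1)])
        show "continuous_on UNIV (\<lambda>x. e \<bullet> (v x *\<^sub>R grad \<eta> x + \<eta> x *\<^sub>R G x))"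
          by (intro continuous_intros c1 c2)
      qed (use eta0 in auto)
      then show ?thesis
        using i1 i2 by (simp add: inner_commute[of e] del: inner_add_left)
    qed
    then have "(LINT y|lebesgue. v y *\<^sub>R grad \<eta> y) + (LINT y|lebesgue. \<eta> y *\<^sub>R G y) = 0"
      using Bochner_Integration.integral_add[OF i1 i2] inner_eq_zero_iff by metis
    moreover have "indicator U y *\<^sub>R v y *\<^sub>R grad \<eta> y = v y *\<^sub>R grad \<eta> y"
      "indicator U y *\<^sub>R \<eta> y *\<^sub>R G y = \<eta> y *\<^sub>R G y" for y
      using eta0[of y] grad0[of y] K(3) by (cases "y \<in> U"; auto)+
    ultimately show ?thesis by (simp only: set_lebesgue_integral_def eq_neg_iff_add_eq_0)
  qed
  ultimately show ?thesis by (auto simp: has_weak_gradient_def)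
qed

text \<open>\<open>\<eta>\<close> is bounded on its compact support, where \<open>G\<close> is
  integrable, and the product vanishes elsewhere.\<close>

lemma set_integrable_locally_integrable_test_function:
  fixes G :: "'a::euclidean_space \<Rightarrow> 'b::euclidean_space"
  assumes G: "locally_integrable U G" and eta: "\<eta> \<in> Cc_infty U"
  shows "set_integrable lebesgue U (\<lambda>y. \<eta> y *\<^sub>R G y)"
proof -
  define K where "K = closure {x. \<eta> x \<noteq> 0}"
  have K: "compact K" "K \<subseteq> U"
    using eta by (auto simp: K_def Cc_infty_def compactly_contained_def)
  have eta0: "\<eta> x = 0" if "x \<notin> K" for x
    using that closure_subset[of "{x. \<eta> x \<noteq> 0}"] by (auto simp: K_def)
  have etac: "continuous_on UNIV \<eta>" using eta by (rule Cc_inftyD)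
  have "bounded (\<eta> ` K)"
    using K(1) etac by (intro compact_imp_bounded compact_continuous_image)
      (auto intro: continuous_on_subset)
  then obtain B where B: "\<And>x. x \<in> K \<Longrightarrow> \<bar>\<eta> x\<bar> \<le> B" unfolding bounded_iff by auto
  have int: "integrable lebesgue (\<lambda>x. indicator K x *\<^sub>R G x)"
    using G K unfolding locally_integrable_def set_integrable_def by blast
  have "\<eta> \<in> borel_measurable lebesgue"
    using borel_measurable_continuous_onI[OF etac] by (intro measurable_completion) simp
  then have "(\<lambda>x. \<eta> x *\<^sub>R (indicator K x *\<^sub>R G x)) \<in> borel_measurable lebesgue"
    using borel_measurable_integrable[OF int] by (rule borel_measurable_scaleR)
  then have "integrable lebesgue (\<lambda>x. \<eta> x *\<^sub>R (indicator K x *\<^sub>R G x))"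
  proof (rule Bochner_Integration.integrable_bound[rotated])
    show "integrable lebesgue (\<lambda>x. B *\<^sub>R (indicator K x *\<^sub>R G x))"
      using int by (rule integrable_scaleR_right)
    have "\<bar>\<eta> x\<bar> * norm (G x) \<le> \<bar>B\<bar> * norm (G x)" if "x \<in> K" for x
      using B[OF that] by (intro mult_right_mono) auto
    then show "AE x in lebesgue. norm (\<eta> x *\<^sub>R (indicator K x *\<^sub>R G x))
        \<le> norm (B *\<^sub>R (indicator K x *\<^sub>R G x))"
      by (auto simp: indicator_def)
  qed
  moreover have "\<eta> x *\<^sub>R (indicator K x *\<^sub>R G x) = indicator U x *\<^sub>R (\<eta> x *\<^sub>R G x)" for x
    using eta0[of x] K(2) by (cases "x \<in> K") auto
  ultimately show ?thesis by (simp only: set_integrable_def)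
qed

text \<open>Continuity on a compact superset gives integrability; \<open>p > 0\<close> keeps the
  power continuous at zeros of \<open>h\<close>.\<close>

lemma Lp_on_continuous:
  fixes h :: "'a::euclidean_space \<Rightarrow> 'b::euclidean_space"
  assumes "open U" "compact K" "U \<subseteq> K" "continuous_on K h" "p > 0"
  shows "h \<in> Lp_on p U"
proof -
  have U: "U \<in> sets lebesgue" using assms(1) by simp
  have "set_integrable lebesgue U h"
    by (rule set_integrable_subset[OF set_integrable_lebesgue_compact[OF assms(2,4)] U assms(3)])
  then have "set_borel_measurable lebesgue U h"
    unfolding set_integrable_def set_borel_measurable_def by (rule borel_measurable_integrable)
  moreover have "continuous_on K (\<lambda>x. norm (h x) powr p)"
    using assms(4,5) by (intro continuous_on_powr' continuous_intros) auto
  then have "set_integrable lebesgue U (\<lambda>x. norm (h x) powr p)"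
    by (rule set_integrable_subset[OF set_integrable_lebesgue_compact[OF assms(2)] U assms(3)])
  ultimately show ?thesis by (simp add: Lp_on_def)
qed

subsection \<open>Integrals of odd functions\<close>

text \<open>The substitution of \<open>- x\<close> for \<open>x\<close> shows that the integral
  equals its own negative.\<close>

lemma set_integral_odd:
  fixes f :: "'a::euclidean_space \<Rightarrow> 'b::euclidean_space"
  assumes "\<And>x. x \<in> U \<Longrightarrow> - x \<in> U" "\<And>x. x \<in> U \<Longrightarrow> f (- x) = - f x"
  shows "(LINT x:U|lebesgue. f x) = 0"
proof -
  let ?g = "\<lambda>x. indicator U x *\<^sub>R f x"
  have "?g (- x) = - ?g x" for x
    \<comment> \<open>The instance at \<open>- x\<close> shows that \<open>- x\<close> lies outside
      \<open>U\<close> whenever \<open>x\<close> does.\<close>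
    using assms(1)[of x] assms(1)[of "- x"] assms(2)[of x] by (auto simp: indicator_def)
  then have "(LINT x|lebesgue. ?g x) = - (LINT x|lebesgue. ?g x)"
    using lebesgue_integral_affine[of "-1" ?g 0] by simp
  then have "2 *\<^sub>R (LINT x|lebesgue. ?g x) = 0"
    by (metis eq_neg_iff_add_eq_0 scaleR_2)
  then show ?thesis by (simp add: set_lebesgue_integral_def)
qed

subsection \<open>The dipole potential\<close>

lemma open_annulus: "open (annulus r R)"
  by (simp add: annulus_def open_Diff)

lemma nonzero_annulus: "r \<ge> 0 \<Longrightarrow> y \<in> annulus r R \<Longrightarrow> y \<noteq> 0"
  by (auto simp: annulus_def)

lemma uminus_annulus: "y \<in> annulus r R \<Longrightarrow> - y \<in> annulus r R"
  by (auto simp: annulus_def)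

lemma grad_rho:
  assumes "y \<noteq> 0"
  shows "grad rho y = - (inverse (norm y) ^ 3 *\<^sub>R y)"
proof (rule grad_eq)
  show "GDERIV rho y :> - (inverse (norm y) ^ 3 *\<^sub>R y)"
    using has_derivative_inverse_norm[OF assms]
    by (simp add: gderiv_def rho_def[abs_def] inner_commute mult.commute)
qed

lemma norm_grad_rho:
  assumes "y \<noteq> 0"
  shows "norm (grad rho y) = inverse (norm y) ^ 2"
proof -
  have "norm (grad rho y) = inverse (norm y) ^ 3 * norm y"
    by (simp add: grad_rho[OF assms])
  also have "\<dots> = inverse (norm y) ^ 2"
    using assms by (simp add: power3_eq_cube power2_eq_square)
  finally show ?thesis .
qed

text \<open>With \<open>t = inverse (norm y)\<close>, the powers and quotients in \<open>phi\<close>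
  become polynomial in \<open>norm y\<close>. The shape with \<open>+ (-1)\<close> and
  \<open>* (1/2)\<close> suits the closure rules for \<open>C_k_on\<close>. At the origin the
  identity rests on the convention that the inverse of 0 is 0.\<close>

lemma phi_rho:
  "phi \<psi> (rho y) = norm y ^ 3 * (1/2 * \<psi> (norm y * (1/2) + (-1)) + (-1) * \<psi> (norm y + (-1)))"
proof -
  have 1: "rho y powi (-3) = norm y ^ 3"
    by (simp only: rho_def power_int_minus inverse_inverse_eq power_inverse[symmetric]
        power_int_numeral power_int_inverse)
  have "1 / (2 * rho y) = norm y * (1/2)"
    by (simp only: rho_def divide_inverse inverse_mult_distrib inverse_inverse_eq mult_1_left mult.commute)
  then have 2: "1 / (2 * rho y) - 1 = norm y * (1/2) + (-1)"
    by (simp only: diff_conv_add_uminus)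
  have 3: "1 / rho y - 1 = norm y + (-1)"
    by (simp only: rho_def divide_inverse inverse_inverse_eq mult_1_left diff_conv_add_uminus)
  show ?thesis
    unfolding phi_def 1 2 3 by (simp only: diff_conv_add_uminus mult_minus1)
qed

text \<open>On the annulus the weight is built from \<open>\<psi>\<close>, \<open>norm\<close>, its
  inverse and an inner product, hence smooth. Its support lies in that of
  \<open>phi \<psi> (rho y)\<close>, so extension by zero keeps it smooth.\<close>

lemma test_function_Cc_infty:
  fixes b :: "real^3"
  assumes psi: "C_infty \<psi>" and r: "0 < r"
    and supp: "compactly_contained {y. phi \<psi> (rho y) \<noteq> 0} (annulus r R)"
  shows "(\<lambda>y. phi \<psi> (rho y) * norm (grad rho y) * (grad rho y \<bullet> b)) \<in> Cc_infty (annulus r R)"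
    (is "?\<eta> \<in> _")
proof -
  let ?U = "annulus r R"
  define K where "K = closure {y. phi \<psi> (rho y) \<noteq> 0}"
  have K: "compact K" "K \<subseteq> ?U" using supp by (auto simp: compactly_contained_def K_def)
  have 0: "?\<eta> y = 0" if "y \<notin> K" for y
    using that closure_subset[of "{y. phi \<psi> (rho y) \<noteq> 0}"] by (auto simp: K_def)
  have U: "open ?U" "0 \<notin> ?U" using open_annulus nonzero_annulus[of r 0 R] r by auto
  have "C_k_on ?U n ?\<eta>" for n
  proof (rule C_k_on_cong[OF U(1)])
    let ?f = "\<lambda>y. (norm y ^ 3 * (1/2 * \<psi> (norm y * (1/2) + (-1)) + (-1) * \<psi> (norm y + (-1))))
       * inverse (norm y) ^ 2 * ((-1) * (inverse (norm y) ^ 3 * (y \<bullet> b)))"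
    have "C_k n \<psi>" using psi by (simp add: C_infty_def)
    then show "C_k_on ?U n ?f"
      by (intro C_k_on_mult C_k_on_add C_k_on_power C_k_on_const C_k_on_inner C_k_on_norm
          C_k_on_inverse_norm C_k_on_compose[of _ _ \<psi>] U)
    show "?f y = ?\<eta> y" if "y \<in> ?U" for y
    proof -
      have "y \<noteq> 0" using U(2) that by auto
      then show ?thesis unfolding phi_rho norm_grad_rho[OF \<open>y \<noteq> 0\<close>]
        by (simp add: grad_rho)
    qed
  qed
  then have "C_infty ?\<eta>"
    using C_infty_zero_extension[OF U(1) compact_imp_closed[OF K(1)] K(2)] 0 by blast
  moreover have "closure {y. ?\<eta> y \<noteq> 0} \<subseteq> K"
    unfolding K_def by (rule closure_mono) auto
  then have "compactly_contained {y. ?\<eta> y \<noteq> 0} ?U"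
    using compact_Int_closed[OF K(1) closed_closure, of "{y. ?\<eta> y \<noteq> 0}"] K(2)
    by (simp only: compactly_contained_def Int_absorb1 subset_trans simp_thms)
  ultimately show ?thesis by (simp add: Cc_infty_def)
qed

text \<open>The classical gradient of the dipole, in inverse powers of the norm.\<close>

definition grad_dipole :: "'a::real_inner \<Rightarrow> 'a \<Rightarrow> 'a" where
  "grad_dipole q y = inverse (norm y) ^ 3 *\<^sub>R q - (3 * (q \<bullet> y) * inverse (norm y) ^ 5) *\<^sub>R y"

lemma GDERIV_dipole:
  fixes q y :: "'a::real_inner"
  assumes "y \<noteq> 0"
  shows "GDERIV (\<lambda>y. (q \<bullet> y) / norm y ^ 3) y :> grad_dipole q y"
proof -
  \<comment> \<open>With the inverse norm as an atom, the comparison of derivatives is a polynomial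
    identity.\<close>
  define i where "i = inverse (norm y)"
  have 1: "((\<lambda>y. q \<bullet> y) has_derivative (\<lambda>h. q \<bullet> h)) (at y)"
    by (rule has_derivative_inner_right[OF has_derivative_ident])
  have 2: "((\<lambda>y. inverse (norm y) ^ 3) has_derivative (\<lambda>h. 3 * ((-1) * ((y \<bullet> h) * i ^ 3)) * i ^ 2)) (at y)"
    using has_derivative_power[OF has_derivative_inverse_norm[OF assms], of 3]
    by (simp add: i_def mult.assoc)
  have "(q \<bullet> y) * (3 * ((-1) * ((y \<bullet> h) * i ^ 3)) * i ^ 2) + (q \<bullet> h) * i ^ 3
      = h \<bullet> grad_dipole q y" for h
    unfolding grad_dipole_def i_def[symmetric] inner_diff_right inner_scaleR_right
      inner_commute[of q h] inner_commute[of y h]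
    by algebra
  then have "((\<lambda>y. (q \<bullet> y) * inverse (norm y) ^ 3) has_derivative (\<lambda>h. h \<bullet> grad_dipole q y)) (at y)"
    using has_derivative_mult[OF 1 2] by (simp only: i_def[symmetric])
  then show ?thesis by (simp only: gderiv_def divide_inverse power_inverse)
qed

lemma grad_dipole_uminus: "grad_dipole q (- y) = grad_dipole q y"
  by (simp add: grad_dipole_def)

lemma continuous_on_grad_dipole: "0 \<notin> S \<Longrightarrow> continuous_on S (grad_dipole q)"
  unfolding grad_dipole_def by (intro continuous_intros) auto

lemma has_weak_gradient_dipole:
  assumes "r \<ge> 0"
  shows "has_weak_gradient (annulus r R) (\<lambda>y. (q \<bullet> y) / norm y ^ 3) (grad_dipole q)"
  using nonzero_annulus[OF assms]
  by (intro has_weak_gradient_classical open_annulus GDERIV_dipole continuous_on_grad_dipole) auto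

lemma dipole_W1p:
  assumes "r > 0" "p > 0"
  shows "(\<lambda>y. (q \<bullet> y) / norm y ^ 3) \<in> W1p p (annulus r R)"
proof -
  \<comment> \<open>The closed annulus is compact and avoids the origin, so the dipole and its
    gradient are continuous on it.\<close>
  let ?K = "cball 0 R - ball (0::real^3) r"
  have K: "compact ?K" "annulus r R \<subseteq> ?K" "0 \<notin> ?K"
    using assms by (auto simp: annulus_def compact_diff)
  have "continuous_on ?K (\<lambda>y. (q \<bullet> y) / norm y ^ 3)"
    using K(3) by (intro continuous_intros) auto
  then have "(\<lambda>y. (q \<bullet> y) / norm y ^ 3) \<in> Lp_on p (annulus r R)"
    by (intro Lp_on_continuous[OF open_annulus K(1,2)] assms)
  moreover have "grad_dipole q \<in> Lp_on p (annulus r R)"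
    by (intro Lp_on_continuous[OF open_annulus K(1,2)] assms continuous_on_grad_dipole K)
  ultimately show ?thesis
    using has_weak_gradient_dipole[of r R q] assms(1) unfolding W1p_def by auto
qed

section \<open>Vanishing of the three integrals for the dipole\<close>

theorem lemma6p2:
  fixes \<psi> :: "real \<Rightarrow> real" and r R p :: real and q :: "real^3"
  assumes "\<psi> \<in> Cc_infty {0<..<1}"
    and "\<And>t. \<psi> t \<ge> 0"
    and "(LINT t:{0<..<1}|lebesgue. \<psi> t) = 1"
    and "0 < r" and "r < R"
    and "compactly_contained {y. phi \<psi> (rho y) \<noteq> 0} (annulus r R)"
    and "p > 3"
  shows "(\<lambda>y. (q \<bullet> y) / norm y ^ 3) \<in> W1p p (annulus r R) \<and>
         L_D (annulus r R) (phi \<psi>) (\<lambda>_. 0) (\<lambda>y. (q \<bullet> y) / norm y ^ 3) = 0"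
proof
  let ?U = "annulus r R" and ?v = "\<lambda>y. (q \<bullet> y) / norm y ^ 3"
  show "?v \<in> W1p p ?U" using assms by (intro dipole_W1p) auto
  have nz: "y \<noteq> 0" if "y \<in> ?U" for y using nonzero_annulus[OF less_imp_le[OF assms(4)] that] .
  have rho_minus: "rho (- y) = rho y" for y by (simp add: rho_def)
  have grad_rho_minus: "grad rho (- y) = - grad rho y" if "y \<noteq> 0" for y
    using that by (simp add: grad_rho)
  \<comment> \<open>The radial weight is even and the dipole is odd.\<close>
  have first: "(LINT y:?U|lebesgue. deriv (phi \<psi>) (rho y) * norm (grad rho y) ^ 3 * ?v y) = 0"
    by (rule set_integral_odd) (auto simp: uminus_annulus rho_minus grad_rho_minus nz)
  define G where "G = weak_grad ?U ?v"
  have G: "has_weak_gradient ?U ?v G"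
    \<comment> \<open>The classical gradient witnesses that the choice in \<open>weak_grad\<close>
      is from a nonempty set.\<close>
    unfolding G_def weak_grad_def by (rule someI_ex[of "has_weak_gradient ?U ?v"])
      (use has_weak_gradient_dipole[OF less_imp_le[OF assms(4)]] in blast)
  define \<eta> where "\<eta> b y = phi \<psi> (rho y) * norm (grad rho y) * (grad rho y \<bullet> b)" for b y
  have eta: "\<eta> b \<in> Cc_infty ?U" for b
    unfolding \<eta>_def[abs_def] using assms(1,4,6)
    by (intro test_function_Cc_infty) (auto simp: Cc_infty_def)
  have eta_G: "(LINT y:?U|lebesgue. \<eta> b y *\<^sub>R G y) = 0" for b
  proof -
    \<comment> \<open>Both sides equal minus the integral of \<open>?v\<close> against the gradient
      of \<open>\<eta> b\<close>. The right side then vanishes, as \<open>\<eta> b\<close> is odd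
      and \<open>grad_dipole q\<close> even.\<close>
    have "(LINT y:?U|lebesgue. \<eta> b y *\<^sub>R G y) = (LINT y:?U|lebesgue. \<eta> b y *\<^sub>R grad_dipole q y)"
      using G has_weak_gradient_dipole[OF less_imp_le[OF assms(4)], of R q] eta[of b]
      unfolding has_weak_gradient_def by force
    also have "\<dots> = 0"
      by (rule set_integral_odd)
        (auto simp: uminus_annulus \<eta>_def rho_minus grad_rho_minus nz grad_dipole_uminus)
    finally show ?thesis .
  qed
  have int: "integrable lebesgue (\<lambda>y. indicator ?U y *\<^sub>R (\<eta> b y *\<^sub>R G y))" for b
    using set_integrable_locally_integrable_test_function[OF _ eta] G
    unfolding has_weak_gradient_def set_integrable_def by blast
  \<comment> \<open>Expanding the inner product in the basis writes the scalar integral as a sum of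
    components of the vector integrals in \<open>eta_G\<close>; \<open>int\<close> justifies
    exchanging sum and integral.\<close>
  have "(LINT y:?U|lebesgue. phi \<psi> (rho y) * norm (grad rho y) * (grad rho y \<bullet> G y))
      = (LINT y|lebesgue. (\<Sum>b\<in>Basis. (indicator ?U y *\<^sub>R (\<eta> b y *\<^sub>R G y)) \<bullet> b))"
    unfolding set_lebesgue_integral_def
    by (intro Bochner_Integration.integral_cong refl, subst euclidean_inner)
      (simp add: \<eta>_def sum_distrib_left mult_ac)
  also have "\<dots> = (\<Sum>b\<in>Basis. (LINT y:?U|lebesgue. \<eta> b y *\<^sub>R G y) \<bullet> b)"
    unfolding set_lebesgue_integral_def using int
    by (subst Bochner_Integration.integral_sum) (auto simp del: inner_scaleR_left)
  also have "\<dots> = 0" by (simp add: eta_G)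
  finally have second:
    "(LINT y:?U|lebesgue. phi \<psi> (rho y) * norm (grad rho y) * (grad rho y \<bullet> G y)) = 0" .
  show "L_D ?U (phi \<psi>) (\<lambda>_. 0) ?v = 0"
    unfolding L_D_def first G_def[symmetric] second
    by (simp add: trace_def set_lebesgue_integral_def)
qed

end
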